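(* Let $\{W_i \}_{i\in I}$ be a family of closed subspaces in a separable Hilbert space $\mathcal{H}$, and let $\{v_i\}_{i \in I}$ be a family of weights, i.e., $v_i>0$ for all $i\in I$. Then the following conditions are equivalent. (1) $\{W_i \}_{i\in I}$ is a frame of subspaces with respect to $\{v_i\}_{i \in I}$ for $\mathcal{H}$. (2) The synthesis operator $T_{W,v}$ is bounded, linear and onto. (3) The analysis operator $T^*_{W,v}$ is a (possibly into) isomorphism.
   Context: For a closed subspace $W$ of $\mathcal{H}$, $\pi_W$ denotes the orthogonal projection onto $W$. A family $\{W_i\}_{i\in I}$ of closed subspaces is a frame of subspaces with respect to $\{v_i\}_{i\in I}$ for $\mathcal{H}$ if there are constants $0<C\le D<\infty$ such that $C\|f\|^2 \le \sum_{i\in I} v_i^2\|\pi_{W_i}(f)\|^2 \le D\|f\|^2$ for all $f\in\mathcal{H}$. The Hilbert space $\left(\sum_{i\in I}\oplus W_i\right)_{\ell_2}$ consists of all families $\{f_i\}_{i\in I}$ with $f_i\in W_i$ and $\sum_i\|f_i\|^2<\infty$, with inner product $\sum_i\langle f_i,g_i\rangle$. The synthesis operator is $T_{W,v}:\left(\sum_{i\in I}\oplus W_i\right)_{\ell_2}\to\mathcal{H}$, $T_{W,v}(\{f_i\}_{i\in I})=\sum_{i\in I}v_if_i$; condition (2) includes that these series converge unconditionally for all elements of the domain, so that $T_{W,v}$ is a well-defined map. The analysis operator is the adjoint $T_{W,v}^*$, given by $T_{W,v}^*(f)=\{v_i\pi_{W_i}(f)\}_{i\in I}$. "(Possibly into)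 isomorphism" in (3) means: this formula defines a bounded linear operator from $\mathcal{H}$ into $\left(\sum_{i\in I}\oplus W_i\right)_{\ell_2}$ that is an isomorphism onto its range, i.e., it is also bounded below (the range need not be the whole space). *)

theory Defs
  imports "HOL-Analysis.Analysis" "HOL-Library.Function_Algebras"
begin

text \<open>
  The scalar field of a Hilbert space is either the reals or the complex numbers, and the class
  below covers exactly these two cases: a commutative normed field over the reals with
  multiplicative norm is isomorphic to one of them, and \<open>z * scnj z = \<bar>z\<bar>\<^sup>2\<close> then forces
  \<open>scnj\<close> to be the identity respectively complex conjugation.
\<close>

class rc_scalar = real_normed_field +
  fixes scnj :: "'a \<Rightarrow> 'a"
  assumes scnj_add: "scnj (x + y) = scnj x + scnj y"
    and scnj_mult: "scnj (x * y) = scnj x * scnj y"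
    and mult_scnj: "x * scnj x = (norm x)\<^sup>2 *\<^sub>R 1"

instantiation real :: rc_scalar
begin
definition scnj_real :: "real \<Rightarrow> real" where "scnj_real x = x"
instance
  by standard (simp_all add: scnj_real_def power2_eq_square)
end

instantiation complex :: rc_scalar
begin
definition scnj_complex :: "complex \<Rightarrow> complex" where "scnj_complex = cnj"
instance
  by standard (simp_all only: scnj_complex_def complex_cnj_add complex_cnj_mult
      complex_norm_square [symmetric] of_real_def [symmetric] of_real_power)
end

text \<open>
  A Hilbert space over the scalars \<open>'k\<close> whose underlying set is the whole type \<open>'a\<close>. The sort
  \<open>banach\<close> provides the norm and its completeness; the last assumption says that this norm
  is the one induced by the inner product.
\<close>

locale hilbert_space = vector_space smul
  for smul :: "'k::rc_scalar \<Rightarrow> 'a::banach \<Rightarrow> 'a" +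
  fixes ip :: "'a \<Rightarrow> 'a \<Rightarrow> 'k"
  assumes smul_of_real: "smul (of_real r) x = r *\<^sub>R x"
    and ip_add_left: "ip (x + y) z = ip x z + ip y z"
    and ip_smul_left: "ip (smul c x) y = c * ip x y"
    and ip_commute: "ip x y = scnj (ip y x)"
    and ip_self: "ip x x = of_real ((norm x)\<^sup>2)"

lemma hilbert_space_real:
  "hilbert_space scaleR ((\<bullet>) :: 'a::{real_inner, banach} \<Rightarrow> 'a \<Rightarrow> real)"
  by unfold_locales
    (simp_all add: inner_add_left inner_commute scnj_real_def dot_square_norm algebra_simps)

lemma hilbert_space_complex: "hilbert_space (*) (\<lambda>x y :: complex. x * cnj y)"
proof -
  have "vector_space ((*) :: complex \<Rightarrow> complex \<Rightarrow> complex)"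
    by unfold_locales (simp_all add: algebra_simps)
  then show ?thesis
    by (intro hilbert_space.intro hilbert_space_axioms.intro)
      (simp_all add: scnj_complex_def algebra_simps scaleR_conv_of_real complex_norm_square
        del: of_real_power)
qed

definition orth_proj :: "('a \<Rightarrow> 'a \<Rightarrow> 'k::zero) \<Rightarrow> 'a::minus set \<Rightarrow> 'a \<Rightarrow> 'a"
  where "orth_proj ip W x = (THE p. p \<in> W \<and> (\<forall>w\<in>W. ip (x - p) w = 0))"

text \<open>Infinite sums over \<open>I\<close> are unordered sums, i.e. convergence is unconditional.\<close>

definition frame_of_subspaces ::
    "('a \<Rightarrow> 'a \<Rightarrow> 'k::zero) \<Rightarrow> 'i set \<Rightarrow> ('i \<Rightarrow> 'a::real_normed_vector set) \<Rightarrow> ('i \<Rightarrow> real) \<Rightarrow> bool"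
  where "frame_of_subspaces ip I W v \<longleftrightarrow>
    (\<exists>C D. 0 < C \<and> C \<le> D \<and>
      (\<forall>f. (\<lambda>i. (v i)\<^sup>2 * (norm (orth_proj ip (W i) f))\<^sup>2) summable_on I \<and>
           C * (norm f)\<^sup>2 \<le> (\<Sum>\<^sub>\<infinity>i\<in>I. (v i)\<^sup>2 * (norm (orth_proj ip (W i) f))\<^sup>2) \<and>
           (\<Sum>\<^sub>\<infinity>i\<in>I. (v i)\<^sup>2 * (norm (orth_proj ip (W i) f))\<^sup>2) \<le> D * (norm f)\<^sup>2))"

text \<open>
  Families indexed by \<open>I\<close> are functions vanishing outside \<open>I\<close>, so that equality of
  functions is equality of families.
\<close>

definition ell2_sum :: "'i set \<Rightarrow> ('i \<Rightarrow> 'a::real_normed_vector set) \<Rightarrow> ('i \<Rightarrow> 'a) set"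
  where "ell2_sum I W =
    {f. (\<forall>i\<in>I. f i \<in> W i) \<and> (\<forall>i. i \<notin> I \<longrightarrow> f i = 0) \<and> (\<lambda>i. (norm (f i))\<^sup>2) summable_on I}"

definition ell2_ip ::
    "('a \<Rightarrow> 'a \<Rightarrow> 'k::real_normed_field) \<Rightarrow> 'i set \<Rightarrow> ('i \<Rightarrow> 'a) \<Rightarrow> ('i \<Rightarrow> 'a) \<Rightarrow> 'k"
  where "ell2_ip ip I f g = (\<Sum>\<^sub>\<infinity>i\<in>I. ip (f i) (g i))"

definition ell2_norm ::
    "('a \<Rightarrow> 'a \<Rightarrow> 'k::real_normed_field) \<Rightarrow> 'i set \<Rightarrow> ('i \<Rightarrow> 'a) \<Rightarrow> real"
  where "ell2_norm ip I f = sqrt (norm (ell2_ip ip I f f))"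

definition ell2_smul :: "('k \<Rightarrow> 'a \<Rightarrow> 'a) \<Rightarrow> 'k \<Rightarrow> ('i \<Rightarrow> 'a) \<Rightarrow> 'i \<Rightarrow> 'a"
  where "ell2_smul smul c f = (\<lambda>i. smul c (f i))"

text \<open>
  \<open>T\<close> restricts to a bounded linear operator from the normed space carried by \<open>X\<close> to the one
  carried by \<open>Y\<close>, where the scalar multiplications and norms are given explicitly because
  \<open>X\<close> or \<open>Y\<close> may be a space of families.
\<close>

definition bounded_linear_operator ::
    "('k \<Rightarrow> 'x::plus \<Rightarrow> 'x) \<Rightarrow> ('x \<Rightarrow> real) \<Rightarrow> 'x set \<Rightarrow>
     ('k \<Rightarrow> 'y::plus \<Rightarrow> 'y) \<Rightarrow> ('y \<Rightarrow> real) \<Rightarrow> 'y set \<Rightarrow> ('x \<Rightarrow> 'y) \<Rightarrow> bool"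
  where "bounded_linear_operator smulX normX X smulY normY Y T \<longleftrightarrow>
    (\<forall>x\<in>X. T x \<in> Y) \<and>
    (\<forall>x\<in>X. \<forall>y\<in>X. T (x + y) = T x + T y) \<and>
    (\<forall>c. \<forall>x\<in>X. T (smulX c x) = smulY c (T x)) \<and>
    (\<exists>K. \<forall>x\<in>X. normY (T x) \<le> K * normX x)"

definition synthesis :: "'i set \<Rightarrow> ('i \<Rightarrow> real) \<Rightarrow> ('i \<Rightarrow> 'a::real_normed_vector) \<Rightarrow> 'a"
  where "synthesis I v f = (\<Sum>\<^sub>\<infinity>i\<in>I. v i *\<^sub>R f i)"

text \<open>
  The formula for the adjoint of the synthesis operator; it makes sense also when the latter is
  not everywhere defined.
\<close>

definition analysis ::
    "('a \<Rightarrow> 'a \<Rightarrow> 'k::zero) \<Rightarrow> 'i set \<Rightarrow> ('i \<Rightarrow> 'a::real_normed_vector set) \<Rightarrow> ('i \<Rightarrow> real) \<Rightarrow>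
     'a \<Rightarrow> 'i \<Rightarrow> 'a"
  where "analysis ip I W v f = (\<lambda>i. if i \<in> I then v i *\<^sub>R orth_proj ip (W i) f else 0)"

text \<open>
  The series have to converge for every element of the domain; without the first conjunct
  \<^const>\<open>infsum\<close> would silently assign the value \<open>0\<close> to a divergent series.
\<close>

definition synthesis_bounded_linear_onto ::
    "('k::rc_scalar \<Rightarrow> 'a::banach \<Rightarrow> 'a) \<Rightarrow> ('a \<Rightarrow> 'a \<Rightarrow> 'k) \<Rightarrow> 'i set \<Rightarrow> ('i \<Rightarrow> 'a set) \<Rightarrow>
     ('i \<Rightarrow> real) \<Rightarrow> bool"
  where "synthesis_bounded_linear_onto smul ip I W v \<longleftrightarrow>
    (\<forall>f\<in>ell2_sum I W. (\<lambda>i. v i *\<^sub>R f i) summable_on I) \<and>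
    bounded_linear_operator (ell2_smul smul) (ell2_norm ip I) (ell2_sum I W)
      smul norm UNIV (synthesis I v) \<and>
    synthesis I v ` ell2_sum I W = UNIV"

definition analysis_into_isomorphism ::
    "('k::rc_scalar \<Rightarrow> 'a::banach \<Rightarrow> 'a) \<Rightarrow> ('a \<Rightarrow> 'a \<Rightarrow> 'k) \<Rightarrow> 'i set \<Rightarrow> ('i \<Rightarrow> 'a set) \<Rightarrow>
     ('i \<Rightarrow> real) \<Rightarrow> bool"
  where "analysis_into_isomorphism smul ip I W v \<longleftrightarrow>
    bounded_linear_operator smul norm UNIV
      (ell2_smul smul) (ell2_norm ip I) (ell2_sum I W) (analysis ip I W v) \<and>
    (\<exists>c>0. \<forall>f. c * norm f \<le> ell2_norm ip I (analysis ip I W v f))"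

end

theory Submission
  imports Defs
begin

text \<open>
  Write \<open>T\<close> for the synthesis and \<open>T'\<close> for the analysis operator. The frame sum of \<open>f\<close> is the squared
  norm of \<open>T' f\<close> in the sum space, so the frame inequalities say that \<open>T'\<close> is bounded and bounded
  below, up to taking square roots of the constants: this is
  \<open>frame_iff_analysis_into_isomorphism\<close>. What remains is the duality that an operator is
  bounded and onto exactly if its adjoint is bounded and bounded below.

  The adjoint relation \<open>ip (T f) g = \<Sum> ip (f i) (T' g i)\<close> follows from the projection theorem,
  which is proved here by a minimizing sequence.
  A bound for \<open>T'\<close> gives the same bound for \<open>T\<close> on finite families
  (\<open>norm_finite_synthesis_le\<close>), and then the Cauchy criterion makes all synthesis series
  converge unconditionally. Conversely, testing \<open>T\<close> on truncated analysis coefficients bounds \<open>T'\<close>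
  (\<open>synthesis_bounded_imp_bessel\<close>).

  If \<open>T'\<close> is bounded below, the frame operator \<open>T \<circ> T'\<close> is positive definite with a positive lower
  bound, and the equation \<open>T (T' x) = y\<close> is solved by Banach's fixed point theorem
  (\<open>synthesis_onto\<close>). If \<open>T\<close> is onto, then the vectors \<open>g\<close> with \<open>T' g\<close> in the unit ball form
  a pointwise bounded family of functionals, hence a norm bounded one by Baire's theorem, which is
  the lower bound for \<open>T'\<close> (\<open>synthesis_onto_imp_analysis_bounded_below\<close>). The Baire
  argument takes place in the Hilbert space itself, not in the sum space as in the open mapping
  theorem.
\<close>

section \<open>Inner products over real or complex scalars\<close>

lemma scnj_0 [simp]: "scnj (0::'k::rc_scalar) = 0"
  using scnj_add[of "0::'k" 0] by simp

lemma scnj_of_real [simp]: "scnj (of_real r :: 'k::rc_scalar) = of_real r"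
proof (cases "r = 0")
  case False
  have "of_real r * scnj (of_real r :: 'k) = of_real r * of_real r"
    using mult_scnj[of "of_real r :: 'k"] by (simp add: power2_eq_square scaleR_conv_of_real)
  with False show ?thesis by simp
qed simp

lemma mult_scnj_of_real: "z * scnj z = of_real ((norm (z::'k::rc_scalar))\<^sup>2)"
  by (simp add: mult_scnj scaleR_conv_of_real)

context hilbert_space
begin

lemma ip_scaleR_left: "ip (r *\<^sub>R x) y = of_real r * ip x y"
  by (metis ip_smul_left smul_of_real)

lemma ip_add_right: "ip x (y + z) = ip x y + ip x z"
  by (metis ip_add_left ip_commute scnj_add)

lemma ip_smul_right: "ip x (smul c y) = scnj c * ip x y"
  by (metis ip_commute ip_smul_left scnj_mult)

lemma ip_scaleR_right: "ip x (r *\<^sub>R y) = of_real r * ip x y"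
  by (metis ip_smul_right scnj_of_real smul_of_real)

lemma ip_zero_left [simp]: "ip 0 y = 0"
  using ip_scaleR_left[of 0 0 y] by simp

lemma ip_zero_right [simp]: "ip x 0 = 0"
  using ip_scaleR_right[of x 0 0] by simp

lemma ip_minus_left: "ip (- x) y = - ip x y"
  using ip_scaleR_left[of "-1" x y] by simp

lemma ip_minus_right: "ip x (- y) = - ip x y"
  using ip_scaleR_right[of x "-1" y] by simp

lemma ip_diff_left: "ip (x - y) z = ip x z - ip y z"
  using ip_add_left[of x "- y" z] by (simp add: ip_minus_left)

lemma ip_diff_right: "ip x (y - z) = ip x y - ip x z"
  using ip_add_right[of x y "- z"] by (simp add: ip_minus_right)

lemma ip_sum_left: "ip (\<Sum>i\<in>F. f i) y = (\<Sum>i\<in>F. ip (f i) y)"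
  by (induction F rule: infinite_finite_induct) (auto simp: ip_add_left)

lemma norm_smul: "norm (smul c x) = norm c * norm x"
proof -
  have "of_real ((norm (smul c x))\<^sup>2) = c * scnj c * ip x x"
    by (simp only: ip_self[symmetric] ip_smul_left ip_smul_right mult_ac)
  also have "\<dots> = of_real ((norm c * norm x)\<^sup>2)"
    by (simp add: mult_scnj_of_real ip_self power_mult_distrib)
  finally have "(norm (smul c x))\<^sup>2 = (norm c * norm x)\<^sup>2"
    using of_real_eq_iff by blast
  then show ?thesis by simp
qed

text \<open>
  A cross term which is known to be real makes it possible to expand a square without speaking
  of real parts, for which the scalar class has no operation.
\<close>

lemma norm_diff_sq:
  assumes "ip u w = of_real a"
  shows "(norm (u - w))\<^sup>2 = (norm u)\<^sup>2 - 2 * a + (norm w)\<^sup>2"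
proof -
  have "ip w u = of_real a"
    by (metis assms ip_commute scnj_of_real)
  then have "of_real ((norm (u - w))\<^sup>2) = (of_real ((norm u)\<^sup>2 - 2 * a + (norm w)\<^sup>2) :: 'k)"
    using assms unfolding ip_self[symmetric] ip_diff_left ip_diff_right
    by (simp add: ip_self)
  then show ?thesis using of_real_eq_iff by blast
qed

text \<open>
  Subtracting from \<open>u\<close> its component along \<open>w\<close>: the identity behind both the Cauchy-Schwarz
  inequality and the orthogonality of nearest points.
\<close>

lemma norm_diff_proj_line_sq:
  assumes "w \<noteq> 0"
  shows "(norm (u - smul (ip u w / of_real ((norm w)\<^sup>2)) w))\<^sup>2
    = (norm u)\<^sup>2 - (norm (ip u w))\<^sup>2 / (norm w)\<^sup>2"
proof -
  define r where "r = inverse ((norm w)\<^sup>2)"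
  have nw: "(norm w)\<^sup>2 * r = 1" using assms by (simp add: r_def)
  have c: "ip u w / of_real ((norm w)\<^sup>2) = ip u w * of_real r"
    by (simp add: r_def divide_inverse)
  have "ip u (smul (ip u w * of_real r) w) = of_real ((norm (ip u w))\<^sup>2 * r)"
  proof -
    have "ip u (smul (ip u w * of_real r) w) = (ip u w * scnj (ip u w)) * of_real r"
      by (simp add: ip_smul_right scnj_mult)
    then show ?thesis by (simp only: mult_scnj_of_real of_real_mult)
  qed
  note norm_diff_sq[OF this]
  moreover have "(norm (smul (ip u w * of_real r) w))\<^sup>2
      = (norm (ip u w))\<^sup>2 * r * ((norm w)\<^sup>2 * r)"
    by (simp add: norm_smul norm_mult power_mult_distrib) (simp add: power2_eq_square)
  moreover have "(norm (ip u w))\<^sup>2 / (norm w)\<^sup>2 = (norm (ip u w))\<^sup>2 * r"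
    by (simp add: r_def divide_inverse)
  ultimately show ?thesis unfolding c nw by linarith
qed

lemma ip_cauchy_schwarz: "norm (ip x y) \<le> norm x * norm y"
proof (cases "y = 0")
  case False
  have "0 \<le> (norm x)\<^sup>2 - (norm (ip x y))\<^sup>2 / (norm y)\<^sup>2"
    using norm_diff_proj_line_sq[OF False, of x] by (metis zero_le_power2)
  with False have "(norm (ip x y))\<^sup>2 \<le> (norm x * norm y)\<^sup>2"
    by (simp add: power_mult_distrib pos_divide_le_eq)
  then show ?thesis by (rule power2_le_imp_le) simp
qed simp

lemma bounded_linear_ip_left: "bounded_linear (\<lambda>x. ip x y)"
  by (rule bounded_linear_intro[where K = "norm y"])
    (auto simp: ip_add_left ip_scaleR_left scaleR_conv_of_real ip_cauchy_schwarz)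

lemma bounded_linear_smul: "bounded_linear (smul c)"
proof (rule bounded_linear_intro[where K = "norm c"])
  show "smul c (r *\<^sub>R x) = r *\<^sub>R smul c x" for r x
    by (metis scale_left_commute smul_of_real)
qed (simp_all add: scale_right_distrib norm_smul)

lemma parallelogram:
  fixes x y :: 'a
  shows "(norm (x + y))\<^sup>2 + (norm (x - y))\<^sup>2 = 2 * (norm x)\<^sup>2 + 2 * (norm y)\<^sup>2"
proof -
  have "ip (x + y) (x + y) + ip (x - y) (x - y) = 2 * ip x x + 2 * ip y y"
    by (simp add: ip_add_left ip_add_right ip_diff_left ip_diff_right)
  then have "of_real ((norm (x + y))\<^sup>2 + (norm (x - y))\<^sup>2)
      = (of_real (2 * (norm x)\<^sup>2 + 2 * (norm y)\<^sup>2) :: 'k)"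
    unfolding ip_self by simp
  then show ?thesis using of_real_eq_iff by blast
qed

lemma subspace_scaleR: "subspace V \<Longrightarrow> x \<in> V \<Longrightarrow> r *\<^sub>R x \<in> V"
  by (metis smul_of_real subspace_scale)

section \<open>Orthogonal projections\<close>

text \<open>
  By the parallelogram law, two points of \<open>V\<close> whose distance from \<open>x\<close> is almost minimal are
  close to each other, because their midpoint, again in \<open>V\<close>, cannot be much nearer to \<open>x\<close>
  than they are. So minimizing sequences are Cauchy.
\<close>

lemma nearest_point_exists:
  assumes "subspace V" "closed V"
  shows "\<exists>p\<in>V. \<forall>w\<in>V. norm (x - p) \<le> norm (x - w)"
proof -
  define d where "d = (INF w\<in>V. (norm (x - w))\<^sup>2)"
  have ne: "V \<noteq> {}" using assms(1) subspace_0 by blast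
  have bdd: "bdd_below ((\<lambda>w. (norm (x - w))\<^sup>2) ` V)"
    by (rule bdd_belowI2[where m = 0]) simp
  have d_le: "d \<le> (norm (x - w))\<^sup>2" if "w \<in> V" for w
    unfolding d_def using bdd that by (rule cINF_lower)
  have "\<exists>w. w \<in> V \<and> (norm (x - w))\<^sup>2 < d + inverse (real (Suc n))" for n
    using cINF_less_iff[OF ne bdd, of "d + inverse (real (Suc n))"] by (auto simp: d_def)
  then have "\<exists>u. \<forall>n. u n \<in> V \<and> (norm (x - u n))\<^sup>2 < d + inverse (real (Suc n))"
    by (intro choice allI)
  then obtain u where u: "u n \<in> V" "(norm (x - u n))\<^sup>2 < d + inverse (real (Suc n))" for n
    by blast
  have est: "(norm (u m - u n))\<^sup>2 \<le> 2 * inverse (real (Suc m)) + 2 * inverse (real (Suc n))" for m n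
  proof -
    have mid: "(1/2) *\<^sub>R (u m + u n) \<in> V"
      by (intro subspace_scaleR[OF assms(1)] subspace_add[OF assms(1)] u(1))
    have "(x - u n) + (x - u m) = 2 *\<^sub>R (x - (1/2) *\<^sub>R (u m + u n))"
      by (simp add: scaleR_right_diff_distrib scaleR_2)
    then have "(norm ((x - u n) + (x - u m)))\<^sup>2 = 4 * (norm (x - (1/2) *\<^sub>R (u m + u n)))\<^sup>2"
      by (simp add: power_mult_distrib)
    moreover have "(x - u n) - (x - u m) = u m - u n" by simp
    ultimately show ?thesis
      using parallelogram[of "x - u n" "x - u m"] d_le[OF mid] u(2)[of m] u(2)[of n] by simp
  qed
  have "Cauchy u"
  proof (rule metric_CauchyI)
    fix e :: real assume "0 < e"
    then obtain N where N: "inverse (real (Suc N)) < e\<^sup>2 / 4"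
      using reals_Archimedean[of "e\<^sup>2 / 4"] by auto
    have "dist (u m) (u n) < e" if "N \<le> m" "N \<le> n" for m n
    proof -
      have "inverse (real (Suc m)) \<le> inverse (real (Suc N))"
        "inverse (real (Suc n)) \<le> inverse (real (Suc N))"
        using that by (auto intro!: le_imp_inverse_le)
      then have "(norm (u m - u n))\<^sup>2 < e\<^sup>2" using est[of m n] N by linarith
      then show ?thesis
        unfolding dist_norm by (rule power2_less_imp_less) (use \<open>0 < e\<close> in simp)
    qed
    then show "\<exists>M. \<forall>m\<ge>M. \<forall>n\<ge>M. dist (u m) (u n) < e" by blast
  qed
  then obtain p where p: "u \<longlonglongrightarrow> p"
    using Cauchy_convergent[of u] by (auto simp: convergent_def)
  have pV: "p \<in> V" by (rule closed_sequentially[OF assms(2) u(1) p])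
  have "(norm (x - p))\<^sup>2 \<le> d + 0"
  proof (rule LIMSEQ_le)
    show "(\<lambda>n. (norm (x - u n))\<^sup>2) \<longlonglongrightarrow> (norm (x - p))\<^sup>2"
      by (intro tendsto_intros p)
    show "(\<lambda>n. d + inverse (real (Suc n))) \<longlonglongrightarrow> d + 0"
      by (intro tendsto_intros LIMSEQ_inverse_real_of_nat)
    show "\<exists>N. \<forall>n\<ge>N. (norm (x - u n))\<^sup>2 \<le> d + inverse (real (Suc n))"
      using u(2) by (auto intro: less_imp_le)
  qed
  then have "norm (x - p) \<le> norm (x - w)" if "w \<in> V" for w
    using d_le[OF that] by (intro power2_le_imp_le[OF _ norm_ge_zero]) linarith
  then show ?thesis using pV by (intro bexI[of _ p]) auto
qed

text \<open>
  If \<open>x - p\<close> had a component along \<open>w\<close>, moving \<open>p\<close> by this component would bring it strictly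
  closer to \<open>x\<close>.
\<close>

lemma nearest_point_orthogonal:
  assumes "subspace V" "p \<in> V" "\<forall>w\<in>V. norm (x - p) \<le> norm (x - w)" "w \<in> V"
  shows "ip (x - p) w = 0"
proof (cases "w = 0")
  case False
  define c where "c = ip (x - p) w / of_real ((norm w)\<^sup>2)"
  have "p + smul c w \<in> V" by (intro subspace_add[OF assms(1)] subspace_scale[OF assms(1)] assms(2,4))
  then have "norm (x - p) \<le> norm (x - p - smul c w)"
    using assms(3) by (simp add: diff_diff_eq)
  then have "(norm (x - p))\<^sup>2 \<le> (norm (x - p - smul c w))\<^sup>2" by (simp add: power_mono)
  then have "(norm (ip (x - p) w))\<^sup>2 / (norm w)\<^sup>2 \<le> 0"
    using norm_diff_proj_line_sq[OF False, of "x - p", folded c_def] by linarith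
  with False show ?thesis by (simp add: divide_le_0_iff)
qed simp

lemma orthogonal_projection_unique:
  assumes "subspace V" "p \<in> V" "\<forall>w\<in>V. ip (x - p) w = 0" "q \<in> V" "\<forall>w\<in>V. ip (x - q) w = 0"
  shows "p = q"
proof -
  have "p - q \<in> V" using assms by (simp add: subspace_diff)
  then have "ip (x - q) (p - q) - ip (x - p) (p - q) = 0" using assms by simp
  then have "ip (p - q) (p - q) = 0" by (simp flip: ip_diff_left)
  then show ?thesis by (simp add: ip_self)
qed

lemma orth_proj_eqI:
  assumes "subspace V" "p \<in> V" "\<And>w. w \<in> V \<Longrightarrow> ip (x - p) w = 0"
  shows "orth_proj ip V x = p"
  unfolding orth_proj_def using assms orthogonal_projection_unique by (intro the_equality) blast+

text \<open>
  The projection theorem; it shows that the definite description in \<^const>\<open>orth_proj\<close> denotes.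
\<close>

lemma orth_proj:
  assumes "subspace V" "closed V"
  shows orth_proj_mem: "orth_proj ip V x \<in> V"
    and orth_proj_orthogonal: "w \<in> V \<Longrightarrow> ip (x - orth_proj ip V x) w = 0"
proof -
  obtain p where p: "p \<in> V" "\<forall>w\<in>V. norm (x - p) \<le> norm (x - w)"
    using nearest_point_exists[OF assms] by blast
  then have orth: "ip (x - p) w = 0" if "w \<in> V" for w
    using nearest_point_orthogonal assms(1) that by blast
  with p(1) have "orth_proj ip V x = p" by (intro orth_proj_eqI assms(1))
  with p(1) orth show "orth_proj ip V x \<in> V" "w \<in> V \<Longrightarrow> ip (x - orth_proj ip V x) w = 0"
    by simp_all
qed

lemma orth_proj_add:
  assumes "subspace V" "closed V"
  shows "orth_proj ip V (x + y) = orth_proj ip V x + orth_proj ip V y"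
proof (rule orth_proj_eqI[OF assms(1)])
  fix w assume w: "w \<in> V"
  have "x + y - (orth_proj ip V x + orth_proj ip V y)
    = (x - orth_proj ip V x) + (y - orth_proj ip V y)" by simp
  then show "ip (x + y - (orth_proj ip V x + orth_proj ip V y)) w = 0"
    using orth_proj_orthogonal[OF assms w] by (simp only: ip_add_left) simp
qed (intro subspace_add[OF assms(1)] orth_proj_mem[OF assms])

lemma orth_proj_smul:
  assumes "subspace V" "closed V"
  shows "orth_proj ip V (smul c x) = smul c (orth_proj ip V x)"
proof (rule orth_proj_eqI[OF assms(1)])
  fix w assume w: "w \<in> V"
  then show "ip (smul c x - smul c (orth_proj ip V x)) w = 0"
    using orth_proj_orthogonal[OF assms w] by (simp add: ip_smul_left flip: scale_right_diff_distrib)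
qed (intro subspace_scale[OF assms(1)] orth_proj_mem[OF assms])

text \<open>
  Together with the membership in \<open>V\<close>, this is the self-adjointness of the projection; it makes
  the analysis operator the adjoint of the synthesis operator.
\<close>

lemma ip_orth_proj_right:
  assumes "subspace V" "closed V" "w \<in> V"
  shows "ip w (orth_proj ip V x) = ip w x"
proof -
  have "ip w (x - orth_proj ip V x) = 0"
    by (subst ip_commute) (simp add: orth_proj_orthogonal[OF assms])
  then show ?thesis by (simp add: ip_diff_right)
qed

end

section \<open>Unordered sums\<close>

text \<open>
  The Cauchy criterion for unordered sums. Synthesis series need not converge absolutely, so a
  comparison of norms would not suffice for them.
\<close>

lemma summable_on_CauchyI:
  fixes f :: "'i \<Rightarrow> 'a::banach"
  assumes "\<And>e. e > 0 \<Longrightarrow> \<exists>G. finite G \<and> G \<subseteq> A \<and>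
    (\<forall>F. finite F \<and> F \<subseteq> A - G \<longrightarrow> norm (sum f F) < e)"
  shows "f summable_on A"
proof -
  have "\<exists>P. eventually P (finite_subsets_at_top A) \<and>
      (\<forall>F F'. P F \<and> P F' \<longrightarrow> dist (sum f F) (sum f F') < e)" if "e > 0" for e
  proof -
    obtain G where G: "finite G" "G \<subseteq> A"
      "\<And>F. finite F \<Longrightarrow> F \<subseteq> A - G \<Longrightarrow> norm (sum f F) < e / 2"
      using assms[of "e / 2"] \<open>e > 0\<close> by auto
    have near: "norm (sum f F - sum f G) < e / 2" if "finite F" "G \<subseteq> F" "F \<subseteq> A" for F
    proof -
      have "sum f F - sum f G = sum f (F - G)" using that by (simp add: sum_diff)
      with G(3)[of "F - G"] that show ?thesis by auto
    qed
    have "dist (sum f F) (sum f F') < e"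
      if "finite F" "G \<subseteq> F" "F \<subseteq> A" "finite F'" "G \<subseteq> F'" "F' \<subseteq> A" for F F'
      using dist_triangle_half_l[of "sum f F" "sum f G" e "sum f F'"] near that
      by (simp add: dist_norm)
    moreover have "\<forall>\<^sub>F F in finite_subsets_at_top A. finite F \<and> G \<subseteq> F \<and> F \<subseteq> A"
      using G(1,2) by (auto simp: eventually_finite_subsets_at_top)
    ultimately show ?thesis
      by (intro exI[of _ "\<lambda>F. finite F \<and> G \<subseteq> F \<and> F \<subseteq> A"]) auto
  qed
  then have "cauchy_filter (filtermap (sum f) (finite_subsets_at_top A))"
    by (simp add: cauchy_filter_metric_filtermap)
  then obtain L where "(sum f \<longlongrightarrow> L) (finite_subsets_at_top A)"
    using complete_uniform[where S = "UNIV :: 'a set"] complete_UNIV by (force simp: filterlim_def)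
  then show ?thesis unfolding summable_on_def has_sum_def by blast
qed

lemma summable_on_nonneg_tail_small:
  fixes f :: "'i \<Rightarrow> real"
  assumes "f summable_on A" "\<And>i. i \<in> A \<Longrightarrow> 0 \<le> f i" "e > 0"
  shows "\<exists>G. finite G \<and> G \<subseteq> A \<and> (\<forall>F. finite F \<and> F \<subseteq> A - G \<longrightarrow> sum f F < e)"
proof -
  obtain G where G: "finite G" "G \<subseteq> A" "dist (sum f G) (infsum f A) \<le> e / 2"
    using infsum_finite_approximation[OF assms(1), of "e / 2"] assms(3) by auto
  have "sum f F < e" if F: "finite F" "F \<subseteq> A - G" for F
  proof -
    have "sum f F + sum f G = sum f (F \<union> G)"
      using F G(1) by (intro sum.union_disjoint[symmetric]) auto
    also have "\<dots> \<le> infsum f A"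
      using F G assms by (intro finite_sum_le_infsum) auto
    finally show ?thesis using G(3) assms(3) unfolding dist_real_def by linarith
  qed
  with G show ?thesis by blast
qed

section \<open>Uniform boundedness and the norm of the sum space\<close>

context hilbert_space
begin

text \<open>
  The uniform boundedness principle for the functionals \<open>ip _ g\<close>. By Baire's theorem some
  level set \<open>A n\<close>, on which all these functionals are bounded by \<open>n\<close>, contains a ball. By
  subtracting its centre they are bounded by \<open>2 n\<close> on a ball around \<open>0\<close>, and evaluating there at a
  multiple of \<open>g\<close> bounds the norm of \<open>g\<close>.
\<close>

lemma pointwise_bounded_imp_norm_bounded:
  assumes "\<And>y. \<exists>M. \<forall>g\<in>S. norm (ip y g) \<le> M"
  shows "\<exists>B. \<forall>g\<in>S. norm g \<le> B"
proof -
  define A where "A n = {y. \<forall>g\<in>S. norm (ip y g) \<le> real n}" for n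
  have closed_A: "closed (A n)" for n
  proof -
    have "A n = (\<Inter>g\<in>S. {y. norm (ip y g) \<le> real n})" by (auto simp: A_def)
    then show ?thesis
      by (auto intro!: closed_INT closed_Collect_le continuous_intros
          linear_continuous_on[OF bounded_linear_ip_left])
  qed
  have "(\<Union>n. A n) = UNIV"
  proof -
    have "\<exists>n. y \<in> A n" for y
    proof -
      obtain M where M: "\<And>g. g \<in> S \<Longrightarrow> norm (ip y g) \<le> M" using assms by blast
      obtain n where "M \<le> real n" using real_arch_simple by blast
      with M show ?thesis unfolding A_def by (auto intro: order_trans)
    qed
    then show ?thesis by blast
  qed
  moreover have "euclidean interior_of \<Union>(range A) = {}" if "\<And>n. interior (A n) = {}"
    using that closed_A
    by (intro Baire_category_alt disjI1 completely_metrizable_space_euclidean) auto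
  ultimately have "\<exists>n. interior (A n) \<noteq> {}" by auto
  then obtain n y0 r where r: "r > 0" "ball y0 r \<subseteq> A n"
    by (auto simp: mem_interior)
  have "norm g \<le> 4 * real n / r" if "g \<in> S" for g
  proof (cases "g = 0")
    case False
    define z where "z = (r / (2 * norm g)) *\<^sub>R g"
    have "norm z < r" using False r(1) by (simp add: z_def)
    then have "y0 + z \<in> A n" "y0 \<in> A n" using r by (auto simp: dist_norm subset_iff)
    then have b: "norm (ip (y0 + z) g) \<le> real n" "norm (ip y0 g) \<le> real n"
      using \<open>g \<in> S\<close> by (auto simp: A_def)
    have "ip z g = ip (y0 + z) g - ip y0 g" by (simp add: ip_add_left)
    then have "norm (ip z g) \<le> 2 * real n" using b norm_triangle_ineq4[of "ip (y0 + z) g" "ip y0 g"] by simp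
    moreover have "norm (ip z g) = r / 2 * norm g"
      using False r(1) by (simp add: z_def ip_scaleR_left ip_self norm_mult norm_divide norm_power power2_eq_square)
    ultimately show ?thesis using r(1) by (simp add: field_simps)
  qed (use r(1) in simp)
  then show ?thesis by blast
qed

lemma ell2_norm_eq:
  assumes "(\<lambda>i. (norm (f i))\<^sup>2) summable_on I"
  shows "ell2_norm ip I f = sqrt (\<Sum>\<^sub>\<infinity>i\<in>I. (norm (f i))\<^sup>2)"
proof -
  have "((\<lambda>i. of_real ((norm (f i))\<^sup>2) :: 'k) has_sum of_real (\<Sum>\<^sub>\<infinity>i\<in>I. (norm (f i))\<^sup>2)) I"
    using assms by (intro has_sum_of_real has_sum_infsum)
  then have "ell2_ip ip I f f = of_real (\<Sum>\<^sub>\<infinity>i\<in>I. (norm (f i))\<^sup>2)"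
    unfolding ell2_ip_def ip_self by (rule infsumI)
  then show ?thesis by (simp add: ell2_norm_def infsum_nonneg)
qed

lemma ell2_norm_sq:
  assumes "f \<in> ell2_sum I W"
  shows "(ell2_norm ip I f)\<^sup>2 = (\<Sum>\<^sub>\<infinity>i\<in>I. (norm (f i))\<^sup>2)"
  using assms by (subst ell2_norm_eq) (auto simp: ell2_sum_def infsum_nonneg)

lemma ell2_norm_nonneg: "0 \<le> ell2_norm ip I f"
  by (simp add: ell2_norm_def)

lemma sqrt_sum_le_ell2_norm:
  assumes "f \<in> ell2_sum I W" "finite F" "F \<subseteq> I"
  shows "sqrt (\<Sum>i\<in>F. (norm (f i))\<^sup>2) \<le> ell2_norm ip I f"
proof (rule real_le_lsqrt)
  show "(\<Sum>i\<in>F. (norm (f i))\<^sup>2) \<le> (ell2_norm ip I f)\<^sup>2"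
    unfolding ell2_norm_sq[OF assms(1)] using assms
    by (intro finite_sum_le_infsum) (auto simp: ell2_sum_def)
qed (simp_all add: sum_nonneg ell2_norm_nonneg)

lemma norm_sum_ip_le:
  "norm (\<Sum>i\<in>F. ip (f i) (g i)) \<le> sqrt (\<Sum>i\<in>F. (norm (f i))\<^sup>2) * sqrt (\<Sum>i\<in>F. (norm (g i))\<^sup>2)"
proof -
  have "norm (\<Sum>i\<in>F. ip (f i) (g i)) \<le> (\<Sum>i\<in>F. \<bar>norm (f i)\<bar> * \<bar>norm (g i)\<bar>)"
    by (rule sum_norm_le) (simp add: ip_cauchy_schwarz)
  also have "\<dots> \<le> sqrt (\<Sum>i\<in>F. (norm (f i))\<^sup>2) * sqrt (\<Sum>i\<in>F. (norm (g i))\<^sup>2)"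
    using L2_set_mult_ineq unfolding L2_set_def .
  finally show ?thesis .
qed

end

section \<open>Analysis and synthesis for a family of subspaces\<close>

locale subspace_family = hilbert_space smul ip
  for smul :: "'k::rc_scalar \<Rightarrow> 'a::banach \<Rightarrow> 'a" and ip :: "'a \<Rightarrow> 'a \<Rightarrow> 'k" +
  fixes I :: "'i set" and W :: "'i \<Rightarrow> 'a set" and v :: "'i \<Rightarrow> real"
  assumes subspace_W: "i \<in> I \<Longrightarrow> subspace (W i)"
    and closed_W: "i \<in> I \<Longrightarrow> closed (W i)"
begin

abbreviation "T \<equiv> synthesis I v"
abbreviation "T' \<equiv> analysis ip I W v"
abbreviation "L \<equiv> ell2_sum I W"
abbreviation "lnorm \<equiv> ell2_norm ip I"

lemma analysis_mem: "i \<in> I \<Longrightarrow> T' g i \<in> W i"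
  by (simp add: analysis_def subspace_scaleR orth_proj_mem subspace_W closed_W)

lemma norm_analysis_sq: "i \<in> I \<Longrightarrow> (norm (T' g i))\<^sup>2 = (v i)\<^sup>2 * (norm (orth_proj ip (W i) g))\<^sup>2"
  by (simp add: analysis_def power_mult_distrib)

lemma analysis_add: "T' (x + y) = T' x + T' y"
  by (auto simp: analysis_def fun_eq_iff orth_proj_add subspace_W closed_W scaleR_add_right)

lemma analysis_smul: "T' (smul c x) = ell2_smul smul c (T' x)"
  by (auto simp: analysis_def ell2_smul_def fun_eq_iff orth_proj_smul subspace_W closed_W
      linear_simps(5)[OF bounded_linear_smul])

lemma analysis_mem_ell2_iff: "T' g \<in> L \<longleftrightarrow> (\<lambda>i. (norm (T' g i))\<^sup>2) summable_on I"
  by (auto simp: ell2_sum_def analysis_mem) (simp add: analysis_def)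

text \<open>
  One term of the adjoint relation between synthesis and analysis.
\<close>

lemma ip_analysis:
  assumes "i \<in> I" "w \<in> W i"
  shows "ip w (T' g i) = ip (v i *\<^sub>R w) g"
  using assms by (simp add: analysis_def ip_scaleR_right ip_scaleR_left ip_orth_proj_right
      subspace_W closed_W)

text \<open>
  Boundedness of the analysis operator by \<open>K\<close>, expressed through finite partial sums. In this form
  the convergence of the infinite sums is part of the conclusions, and the condition can be
  tested on families with finite support.
\<close>

definition bessel :: "real \<Rightarrow> bool"
  where "bessel K \<longleftrightarrow> 0 \<le> K \<and>
    (\<forall>g F. finite F \<and> F \<subseteq> I \<longrightarrow> (\<Sum>i\<in>F. (norm (T' g i))\<^sup>2) \<le> (K * norm g)\<^sup>2)"

lemma bessel_imp_analysis_ell2: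
  assumes "bessel K"
  shows "T' g \<in> L" and "lnorm (T' g) \<le> K * norm g"
proof -
  have fin: "(\<Sum>i\<in>F. (norm (T' g i))\<^sup>2) \<le> (K * norm g)\<^sup>2" if "finite F" "F \<subseteq> I" for F
    using assms that by (auto simp: bessel_def)
  then have s: "(\<lambda>i. (norm (T' g i))\<^sup>2) summable_on I"
    by (intro nonneg_bdd_above_summable_on bdd_aboveI2[where M = "(K * norm g)\<^sup>2"]) auto
  then show mem: "T' g \<in> L" by (simp add: analysis_mem_ell2_iff)
  have "(lnorm (T' g))\<^sup>2 \<le> (K * norm g)\<^sup>2"
    unfolding ell2_norm_sq[OF mem] using s fin by (rule infsum_le_finite_sums)
  then show "lnorm (T' g) \<le> K * norm g"
    by (rule power2_le_imp_le) (use assms in \<open>simp add: bessel_def\<close>)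
qed

lemma analysis_bounded_imp_bessel:
  assumes "\<And>g. T' g \<in> L" "\<And>g. lnorm (T' g) \<le> K * norm g" "0 \<le> K"
  shows "bessel K"
  unfolding bessel_def
proof (intro conjI allI impI assms(3))
  fix g F assume "finite F \<and> F \<subseteq> I"
  then have "(\<Sum>i\<in>F. (norm (T' g i))\<^sup>2) \<le> (\<Sum>\<^sub>\<infinity>i\<in>I. (norm (T' g i))\<^sup>2)"
    using assms(1)[of g] by (intro finite_sum_le_infsum) (auto simp: ell2_sum_def)
  also have "\<dots> = (lnorm (T' g))\<^sup>2" using ell2_norm_sq[OF assms(1)] by simp
  also have "\<dots> \<le> (K * norm g)\<^sup>2" using assms(2) by (intro power_mono ell2_norm_nonneg)
  finally show "(\<Sum>i\<in>F. (norm (T' g i))\<^sup>2) \<le> (K * norm g)\<^sup>2" .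
qed

text \<open>
  An adjoint has the same bound as the operator. With \<open>h\<close> the synthesized vector, write its squared
  norm as \<open>ip h h\<close> and move one of the two synthesis operators to the other side.
  Cauchy-Schwarz yields the bound times \<open>norm h\<close>, which cancels.
\<close>

lemma norm_finite_synthesis_le:
  assumes "bessel K" "finite F" "F \<subseteq> I" "\<And>i. i \<in> F \<Longrightarrow> f i \<in> W i"
  shows "norm (\<Sum>i\<in>F. v i *\<^sub>R f i) \<le> K * sqrt (\<Sum>i\<in>F. (norm (f i))\<^sup>2)"
proof -
  define h where "h = (\<Sum>i\<in>F. v i *\<^sub>R f i)"
  have K: "0 \<le> K" "sqrt (\<Sum>i\<in>F. (norm (T' h i))\<^sup>2) \<le> K * norm h"
    using assms(1-3) by (auto simp: bessel_def intro!: real_le_lsqrt sum_nonneg)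
  have "ip h h = (\<Sum>i\<in>F. ip (f i) (T' h i))"
    unfolding h_def ip_sum_left using assms(3,4) by (intro sum.cong) (auto simp: ip_analysis)
  then have "(norm h)\<^sup>2 = norm (\<Sum>i\<in>F. ip (f i) (T' h i))"
    by (metis ip_self norm_of_real abs_power2)
  also have "\<dots> \<le> sqrt (\<Sum>i\<in>F. (norm (f i))\<^sup>2) * sqrt (\<Sum>i\<in>F. (norm (T' h i))\<^sup>2)"
    by (rule norm_sum_ip_le)
  also have "\<dots> \<le> sqrt (\<Sum>i\<in>F. (norm (f i))\<^sup>2) * (K * norm h)"
    by (intro mult_left_mono K) (simp add: sum_nonneg)
  finally have "norm h * norm h \<le> (K * sqrt (\<Sum>i\<in>F. (norm (f i))\<^sup>2)) * norm h"
    by (simp add: power2_eq_square mult_ac)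
  then show ?thesis
    using K(1) by (cases "h = 0") (auto simp: h_def[symmetric] sum_nonneg)
qed

text \<open>
  The finite bound applied to a family supported off a large finite set, where the square sums
  are small, is exactly the Cauchy criterion.
\<close>

lemma synthesis_summable:
  assumes "bessel K" "f \<in> L"
  shows "(\<lambda>i. v i *\<^sub>R f i) summable_on I"
proof (rule summable_on_CauchyI)
  fix e :: real assume "e > 0"
  define d where "d = (e / (K + 1))\<^sup>2"
  have K: "0 \<le> K" using assms(1) by (simp add: bessel_def)
  have "d > 0" using \<open>e > 0\<close> K by (simp add: d_def)
  then obtain G where G: "finite G" "G \<subseteq> I"
    "\<And>F. finite F \<Longrightarrow> F \<subseteq> I - G \<Longrightarrow> (\<Sum>i\<in>F. (norm (f i))\<^sup>2) < d"
    using summable_on_nonneg_tail_small[of "\<lambda>i. (norm (f i))\<^sup>2" I d] assms(2)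
    by (auto simp: ell2_sum_def)
  have "norm (\<Sum>i\<in>F. v i *\<^sub>R f i) < e" if F: "finite F" "F \<subseteq> I - G" for F
  proof -
    have "norm (\<Sum>i\<in>F. v i *\<^sub>R f i) \<le> K * sqrt (\<Sum>i\<in>F. (norm (f i))\<^sup>2)"
      using F assms(2) by (intro norm_finite_synthesis_le[OF assms(1)]) (auto simp: ell2_sum_def)
    also have "\<dots> \<le> K * sqrt d"
      using G(3)[OF F] K by (intro mult_left_mono) auto
    also have "\<dots> = K * (e / (K + 1))" using K \<open>e > 0\<close> by (simp add: d_def)
    also have "\<dots> < e" using K \<open>e > 0\<close> by (simp add: field_simps)
    finally show ?thesis .
  qed
  with G show "\<exists>G. finite G \<and> G \<subseteq> I \<and>
      (\<forall>F. finite F \<and> F \<subseteq> I - G \<longrightarrow> norm (\<Sum>i\<in>F. v i *\<^sub>R f i) < e)"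
    by blast
qed

lemma norm_synthesis_le:
  assumes "bessel K" "f \<in> L"
  shows "norm (T f) \<le> K * lnorm f"
proof -
  have lim: "(sum (\<lambda>i. v i *\<^sub>R f i) \<longlongrightarrow> T f) (finite_subsets_at_top I)"
    using infsum_tendsto[OF synthesis_summable[OF assms]] by (simp add: synthesis_def)
  have K: "0 \<le> K" using assms(1) by (simp add: bessel_def)
  have "norm (\<Sum>i\<in>F. v i *\<^sub>R f i) \<le> K * lnorm f" if F: "finite F \<and> F \<subseteq> I" for F
  proof -
    have "norm (\<Sum>i\<in>F. v i *\<^sub>R f i) \<le> K * sqrt (\<Sum>i\<in>F. (norm (f i))\<^sup>2)"
      using F assms(2) by (intro norm_finite_synthesis_le[OF assms(1)]) (auto simp: ell2_sum_def)
    also have "\<dots> \<le> K * lnorm f"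
      using F assms(2) by (intro mult_left_mono K sqrt_sum_le_ell2_norm) auto
    finally show ?thesis .
  qed
  then have "\<forall>\<^sub>F F in finite_subsets_at_top I. norm (\<Sum>i\<in>F. v i *\<^sub>R f i) \<le> K * lnorm f"
    by (intro eventually_finite_subsets_at_top_weakI) auto
  then show ?thesis
    by (rule tendsto_upperbound[OF tendsto_norm[OF lim]]) simp
qed

text \<open>
  The analysis operator is the adjoint of the synthesis operator.
\<close>

lemma ip_synthesis:
  assumes "f \<in> L" "(\<lambda>i. v i *\<^sub>R f i) summable_on I"
  shows "((\<lambda>i. ip (f i) (T' g i)) has_sum ip (T f) g) I"
proof -
  have "((\<lambda>i. ip (v i *\<^sub>R f i) g) has_sum ip (T f) g) I"
    unfolding synthesis_def
    by (intro has_sum_bounded_linear[OF bounded_linear_ip_left] has_sum_infsum assms(2))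
  moreover have "ip (v i *\<^sub>R f i) g = ip (f i) (T' g i)" if "i \<in> I" for i
    using that assms(1) by (simp add: ip_analysis ell2_sum_def)
  ultimately show ?thesis by (simp cong: has_sum_cong)
qed

text \<open>
  The Cauchy-Schwarz inequality of the sum space, applied to the adjoint relation.
\<close>

lemma norm_ip_synthesis_le:
  assumes "f \<in> L" "(\<lambda>i. v i *\<^sub>R f i) summable_on I" "T' g \<in> L"
  shows "norm (ip (T f) g) \<le> lnorm f * lnorm (T' g)"
proof -
  have lim: "(sum (\<lambda>i. ip (f i) (T' g i)) \<longlongrightarrow> ip (T f) g) (finite_subsets_at_top I)"
    using ip_synthesis[OF assms(1,2)] by (simp add: has_sum_def)
  have "norm (\<Sum>i\<in>F. ip (f i) (T' g i)) \<le> lnorm f * lnorm (T' g)" if F: "finite F" "F \<subseteq> I" for F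
  proof -
    have "norm (\<Sum>i\<in>F. ip (f i) (T' g i))
        \<le> sqrt (\<Sum>i\<in>F. (norm (f i))\<^sup>2) * sqrt (\<Sum>i\<in>F. (norm (T' g i))\<^sup>2)"
      by (rule norm_sum_ip_le)
    also have "\<dots> \<le> lnorm f * lnorm (T' g)"
      using F assms(1,3)
      by (intro mult_mono sqrt_sum_le_ell2_norm) (auto simp: sum_nonneg ell2_norm_nonneg)
    finally show ?thesis .
  qed
  then have "\<forall>\<^sub>F F in finite_subsets_at_top I.
      norm (\<Sum>i\<in>F. ip (f i) (T' g i)) \<le> lnorm f * lnorm (T' g)"
    by (intro eventually_finite_subsets_at_top_weakI) auto
  then show ?thesis
    by (rule tendsto_upperbound[OF tendsto_norm[OF lim]]) simp
qed

lemma synthesis_add: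
  assumes "(\<lambda>i. v i *\<^sub>R f i) summable_on I" "(\<lambda>i. v i *\<^sub>R g i) summable_on I"
  shows "T (f + g) = T f + T g"
  using infsum_add[OF assms] by (simp add: synthesis_def scaleR_add_right)

lemma synthesis_smul:
  assumes "(\<lambda>i. v i *\<^sub>R f i) summable_on I"
  shows "T (ell2_smul smul c f) = smul c (T f)"
proof -
  have "((\<lambda>i. smul c (v i *\<^sub>R f i)) has_sum smul c (T f)) I"
    unfolding synthesis_def
    by (intro has_sum_bounded_linear[OF bounded_linear_smul] has_sum_infsum assms)
  then have "((\<lambda>i. v i *\<^sub>R smul c (f i)) has_sum smul c (T f)) I"
    by (simp add: linear_simps(5)[OF bounded_linear_smul])
  then show ?thesis unfolding synthesis_def ell2_smul_def by (rule infsumI)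
qed

section \<open>The three equivalent conditions\<close>

lemma frame_of_subspaces_iff:
  "frame_of_subspaces ip I W v \<longleftrightarrow>
    (\<exists>C D. 0 < C \<and> C \<le> D \<and>
      (\<forall>f. T' f \<in> L \<and> C * (norm f)\<^sup>2 \<le> (lnorm (T' f))\<^sup>2 \<and> (lnorm (T' f))\<^sup>2 \<le> D * (norm f)\<^sup>2))"
proof -
  have "(T' f \<in> L \<and> C * (norm f)\<^sup>2 \<le> (lnorm (T' f))\<^sup>2 \<and> (lnorm (T' f))\<^sup>2 \<le> D * (norm f)\<^sup>2) \<longleftrightarrow>
      ((\<lambda>i. (v i)\<^sup>2 * (norm (orth_proj ip (W i) f))\<^sup>2) summable_on I \<and>
       C * (norm f)\<^sup>2 \<le> (\<Sum>\<^sub>\<infinity>i\<in>I. (v i)\<^sup>2 * (norm (orth_proj ip (W i) f))\<^sup>2) \<and>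
       (\<Sum>\<^sub>\<infinity>i\<in>I. (v i)\<^sup>2 * (norm (orth_proj ip (W i) f))\<^sup>2) \<le> D * (norm f)\<^sup>2)" for C D f
  proof -
    have "(\<lambda>i. (v i)\<^sup>2 * (norm (orth_proj ip (W i) f))\<^sup>2) summable_on I \<longleftrightarrow> T' f \<in> L"
      unfolding analysis_mem_ell2_iff by (rule summable_on_cong) (simp add: norm_analysis_sq)
    moreover have "(\<Sum>\<^sub>\<infinity>i\<in>I. (v i)\<^sup>2 * (norm (orth_proj ip (W i) f))\<^sup>2) = (lnorm (T' f))\<^sup>2"
      if "T' f \<in> L"
      unfolding ell2_norm_sq[OF that] by (rule infsum_cong) (simp add: norm_analysis_sq)
    ultimately show ?thesis by auto
  qed
  then show ?thesis unfolding frame_of_subspaces_def by simp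
qed

text \<open>
  Linearity of the analysis operator always holds, so being an isomorphism onto the range
  amounts to an upper and a lower norm bound.
\<close>

lemma analysis_into_isomorphism_iff:
  "analysis_into_isomorphism smul ip I W v \<longleftrightarrow>
    (\<exists>K. bessel K) \<and> (\<exists>c>0. \<forall>f. c * norm f \<le> lnorm (T' f))"
proof -
  have "(\<exists>K. bessel K) \<longleftrightarrow> (\<forall>f. T' f \<in> L) \<and> (\<exists>K. \<forall>f. lnorm (T' f) \<le> K * norm f)"
  proof safe
    fix K assume mem: "\<forall>f. T' f \<in> L" and K: "\<forall>f. lnorm (T' f) \<le> K * norm f"
    have "lnorm (T' f) \<le> \<bar>K\<bar> * norm f" for f
      using K mult_right_mono[of K "\<bar>K\<bar>" "norm f"] by (smt (verit) norm_ge_zero)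
    with mem have "bessel \<bar>K\<bar>" by (intro analysis_bounded_imp_bessel) auto
    then show "\<exists>K. bessel K" by blast
  qed (use bessel_imp_analysis_ell2 in blast)+
  then show ?thesis
    by (auto simp: analysis_into_isomorphism_def bounded_linear_operator_def
        analysis_add analysis_smul)
qed

lemma frame_iff_analysis_into_isomorphism:
  "frame_of_subspaces ip I W v \<longleftrightarrow> analysis_into_isomorphism smul ip I W v"
proof
  assume "frame_of_subspaces ip I W v"
  then obtain C D where CD: "0 < C" "C \<le> D" "\<And>f. T' f \<in> L"
    "\<And>f. C * (norm f)\<^sup>2 \<le> (lnorm (T' f))\<^sup>2" "\<And>f. (lnorm (T' f))\<^sup>2 \<le> D * (norm f)\<^sup>2"
    unfolding frame_of_subspaces_iff by blast
  have "lnorm (T' f) \<le> sqrt D * norm f" for f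
    by (rule power2_le_imp_le) (use CD in \<open>simp_all add: power_mult_distrib\<close>)
  then have "bessel (sqrt D)" using CD by (intro analysis_bounded_imp_bessel) auto
  moreover have "sqrt C * norm f \<le> lnorm (T' f)" for f
    by (rule power2_le_imp_le) (use CD in \<open>simp_all add: power_mult_distrib ell2_norm_nonneg\<close>)
  ultimately show "analysis_into_isomorphism smul ip I W v"
    unfolding analysis_into_isomorphism_iff using CD(1) by (meson real_sqrt_gt_zero)
next
  assume "analysis_into_isomorphism smul ip I W v"
  then obtain K c where K: "bessel K" and c: "c > 0" "\<And>f. c * norm f \<le> lnorm (T' f)"
    unfolding analysis_into_isomorphism_iff by blast
  have K0: "0 \<le> K" using K by (simp add: bessel_def)
  have "T' f \<in> L \<and> c\<^sup>2 * (norm f)\<^sup>2 \<le> (lnorm (T' f))\<^sup>2 \<and> (lnorm (T' f))\<^sup>2 \<le> (max K c)\<^sup>2 * (norm f)\<^sup>2"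
    for f
  proof (intro conjI)
    show "T' f \<in> L" by (rule bessel_imp_analysis_ell2[OF K])
    show "c\<^sup>2 * (norm f)\<^sup>2 \<le> (lnorm (T' f))\<^sup>2"
      using c power_mono[OF c(2)[of f], of 2] by (simp add: power_mult_distrib)
    have "lnorm (T' f) \<le> max K c * norm f"
      using bessel_imp_analysis_ell2(2)[OF K, of f] by (rule order_trans) (simp add: mult_right_mono)
    from power_mono[OF this ell2_norm_nonneg, of 2]
    show "(lnorm (T' f))\<^sup>2 \<le> (max K c)\<^sup>2 * (norm f)\<^sup>2" by (simp add: power_mult_distrib)
  qed
  moreover have "c\<^sup>2 \<le> (max K c)\<^sup>2" using c(1) by (intro power_mono) auto
  ultimately show "frame_of_subspaces ip I W v"
    unfolding frame_of_subspaces_iff using c(1) by (meson zero_less_power)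
qed

text \<open>
  The frame operator \<open>S = T \<circ> T'\<close> satisfies \<open>c\<^sup>2 (norm x)\<^sup>2 \<le> ip (S x) x\<close>, and \<open>norm (S x)\<close> is at
  most \<open>M\<^sup>2 * norm x\<close>. As in the Lax-Milgram theorem, a small step \<open>t\<close> makes
  \<open>x \<mapsto> x - t (S x - y)\<close> a contraction, whose fixed point solves \<open>S x = y\<close>. So the families
  in the range of the analysis operator already suffice to reach every \<open>y\<close>.
\<close>

lemma synthesis_onto:
  assumes K: "bessel K" and c: "c > 0" "\<And>f. c * norm f \<le> lnorm (T' f)"
  shows "\<exists>f\<in>L. T f = y"
proof -
  define S where "S x = T (T' x)" for x
  have mem: "T' x \<in> L" and sm: "(\<lambda>i. v i *\<^sub>R T' x i) summable_on I" for x
    using bessel_imp_analysis_ell2[OF K] synthesis_summable[OF K] by auto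
  have S_add: "S (x + z) = S x + S z" for x z
    unfolding S_def analysis_add by (rule synthesis_add[OF sm sm])
  have S_diff: "S (x - z) = S x - S z" for x z
    using S_add[of "x - z" z] by simp
  define N where "N x = lnorm (T' x)" for x
  have K0: "0 \<le> K" using K by (simp add: bessel_def)
  have ipS: "ip (S x) x = of_real ((N x)\<^sup>2)" for x
  proof -
    have "((\<lambda>i. ip (T' x i) (T' x i)) has_sum ip (S x) x) I"
      unfolding S_def by (rule ip_synthesis[OF mem sm])
    moreover have "((\<lambda>i. ip (T' x i) (T' x i)) has_sum of_real ((N x)\<^sup>2)) I"
      unfolding ip_self N_def ell2_norm_sq[OF mem] using mem[of x]
      by (intro has_sum_of_real has_sum_infsum) (simp add: ell2_sum_def)
    ultimately show ?thesis using has_sum_unique by blast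
  qed
  \<comment> \<open>enlarging \<open>K\<close> to at least \<open>c\<close> keeps \<open>q\<close> nonnegative even on the trivial space\<close>
  define M where "M = max K c"
  have M: "c \<le> M" "K \<le> M" "0 < M" using c(1) by (auto simp: M_def)
  have N_le: "N x \<le> M * norm x" for x
    using bessel_imp_analysis_ell2(2)[OF K, of x] mult_right_mono[OF M(2), of "norm x"]
    by (simp add: N_def)
  have S_le: "norm (S x) \<le> M\<^sup>2 * norm x" for x
  proof -
    have "norm (S x) \<le> K * N x" unfolding S_def N_def by (rule norm_synthesis_le[OF K mem])
    also have "\<dots> \<le> M * (M * norm x)"
      using N_le M K0 by (intro mult_mono) (auto simp: N_def ell2_norm_nonneg)
    finally show ?thesis by (simp add: power2_eq_square mult_ac)
  qed
  \<comment> \<open>the minimizer of \<open>1 - 2 t c\<^sup>2 + t\<^sup>2 M\<^sup>4\<close>, with minimum \<open>q\<close>\<close>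
  define t where "t = c\<^sup>2 / M ^ 4"
  define q where "q = 1 - (c / M) ^ 4"
  have t: "0 \<le> t" by (simp add: t_def)
  have "(c / M) ^ 4 \<le> 1" "0 < (c / M) ^ 4" using c(1) M by (auto intro!: power_le_one)
  then have q: "0 \<le> q" "q < 1" by (auto simp: q_def)
  have contr: "norm (u - t *\<^sub>R S u) \<le> sqrt q * norm u" for u
  proof -
    have "ip u (S u) = of_real ((N u)\<^sup>2)" by (metis ip_commute ipS scnj_of_real)
    then have "ip u (t *\<^sub>R S u) = of_real (t * (N u)\<^sup>2)" by (simp add: ip_scaleR_right)
    from norm_diff_sq[OF this]
    have "(norm (u - t *\<^sub>R S u))\<^sup>2 = (norm u)\<^sup>2 - 2 * (t * (N u)\<^sup>2) + t\<^sup>2 * (norm (S u))\<^sup>2"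
      by (simp add: power_mult_distrib)
    also have "\<dots> \<le> (norm u)\<^sup>2 - 2 * (t * (c * norm u)\<^sup>2) + t\<^sup>2 * (M\<^sup>2 * norm u)\<^sup>2"
      using c t S_le[of u] by (intro add_mono diff_mono mult_left_mono power_mono) (auto simp: N_def)
    also have "\<dots> = q * (norm u)\<^sup>2"
      using M(3) by (simp add: t_def q_def power_mult_distrib power_divide field_simps)
    finally have "(norm (u - t *\<^sub>R S u))\<^sup>2 \<le> (sqrt q * norm u)\<^sup>2"
      using q(1) by (simp add: power_mult_distrib)
    then show ?thesis by (rule power2_le_imp_le) (simp add: q(1))
  qed
  define \<phi> where "\<phi> x = x - t *\<^sub>R (S x - y)" for x
  have "dist (\<phi> x) (\<phi> z) \<le> sqrt q * dist x z" for x z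
  proof -
    have "\<phi> x - \<phi> z = (x - z) - t *\<^sub>R S (x - z)"
      by (simp add: \<phi>_def S_diff scaleR_right_diff_distrib)
    with contr[of "x - z"] show ?thesis by (simp add: dist_norm)
  qed
  then obtain x where "\<phi> x = x"
    using banach_fix_type[of "sqrt q" \<phi>] q by auto
  then have "S x = y" using c(1) M(3) by (simp add: \<phi>_def t_def)
  then show ?thesis using mem unfolding S_def by blast
qed

lemma analysis_isomorphism_imp_synthesis_onto:
  assumes "analysis_into_isomorphism smul ip I W v"
  shows "synthesis_bounded_linear_onto smul ip I W v"
proof -
  obtain K c where K: "bessel K" and c: "c > 0" "\<And>f. c * norm f \<le> lnorm (T' f)"
    using assms unfolding analysis_into_isomorphism_iff by blast
  note sm = synthesis_summable[OF K]
  have "T ` L = UNIV" using synthesis_onto[OF K c] by (metis UNIV_eq_I imageI)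
  moreover have "\<exists>K. \<forall>f\<in>L. norm (T f) \<le> K * lnorm f" using norm_synthesis_le[OF K] by blast
  ultimately show ?thesis
    unfolding synthesis_bounded_linear_onto_def bounded_linear_operator_def
    using sm by (auto simp: synthesis_add synthesis_smul)
qed

text \<open>
  The synthesis bound is applied to the analysis coefficients of \<open>g\<close> cut off outside \<open>F\<close>. With \<open>s\<close>
  the norm of this finite family, adjointness gives \<open>s\<^sup>2 \<le> K * s * norm g\<close>.
\<close>

lemma synthesis_bounded_imp_bessel:
  assumes K: "\<And>f. f \<in> L \<Longrightarrow> norm (T f) \<le> K * lnorm f" "0 \<le> K"
  shows "bessel K"
  unfolding bessel_def
proof (intro conjI allI impI K(2))
  fix g F assume F: "finite F \<and> F \<subseteq> I"
  define f where "f i = (if i \<in> F then T' g i else 0)" for i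
  define s where "s = sqrt (\<Sum>i\<in>F. (norm (T' g i))\<^sup>2)"
  have s: "0 \<le> s" "s\<^sup>2 = (\<Sum>i\<in>F. (norm (T' g i))\<^sup>2)" by (simp_all add: s_def sum_nonneg)
  have "((\<lambda>i. (norm (f i))\<^sup>2) has_sum s\<^sup>2) F"
    unfolding s(2) using F by (intro has_sum_finiteI sum.cong) (auto simp: f_def)
  then have sq: "((\<lambda>i. (norm (f i))\<^sup>2) has_sum s\<^sup>2) I"
    by (rule has_sum_cong_neutral[THEN iffD1, rotated -1]) (use F in \<open>auto simp: f_def\<close>)
  then have fL: "f \<in> L"
    using F by (auto simp: ell2_sum_def f_def analysis_mem subspace_0[OF subspace_W] has_sum_imp_summable)
  have "lnorm f = s"
    using ell2_norm_sq[OF fL] infsumI[OF sq] s(1) by (simp add: ell2_norm_nonneg)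
  have "((\<lambda>i. v i *\<^sub>R f i) has_sum (\<Sum>i\<in>F. v i *\<^sub>R T' g i)) F"
    using F by (intro has_sum_finiteI sum.cong) (auto simp: f_def)
  then have "((\<lambda>i. v i *\<^sub>R f i) has_sum (\<Sum>i\<in>F. v i *\<^sub>R T' g i)) I"
    by (rule has_sum_cong_neutral[THEN iffD1, rotated -1]) (use F in \<open>auto simp: f_def\<close>)
  then have Tf: "T f = (\<Sum>i\<in>F. v i *\<^sub>R T' g i)" unfolding synthesis_def by (rule infsumI)
  have "ip (T f) g = (\<Sum>i\<in>F. ip (T' g i) (T' g i))"
    unfolding Tf ip_sum_left using F by (intro sum.cong) (auto simp: ip_analysis analysis_mem)
  also have "\<dots> = of_real (s\<^sup>2)" unfolding s(2) ip_self by simp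
  finally have "s\<^sup>2 = norm (ip (T f) g)" by (simp add: norm_power)
  also have "\<dots> \<le> norm (T f) * norm g" by (rule ip_cauchy_schwarz)
  also have "\<dots> \<le> K * s * norm g"
    using K(1)[OF fL] \<open>lnorm f = s\<close> by (intro mult_right_mono) auto
  finally have "s * s \<le> (K * norm g) * s" by (simp add: power2_eq_square mult_ac)
  then have "s \<le> K * norm g" using s(1) K(2) by (cases "s = 0") auto
  then have "s\<^sup>2 \<le> (K * norm g)\<^sup>2" using s(1) by (rule power_mono)
  then show "(\<Sum>i\<in>F. (norm (T' g i))\<^sup>2) \<le> (K * norm g)\<^sup>2" by (simp add: s(2))
qed

text \<open>
  Every \<open>y\<close> is some \<open>T f\<close>, so \<open>ip y g = ip (T f) g\<close> is at most \<open>lnorm f\<close> for all \<open>g\<close> with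
  \<open>lnorm (T' g) \<le> 1\<close>. Hence the set of these \<open>g\<close> is pointwise bounded, and by uniform boundedness it
  is bounded in norm; by homogeneity this is a lower bound for \<open>T'\<close>.
\<close>

lemma synthesis_onto_imp_analysis_bounded_below:
  assumes K: "bessel K" and onto: "T ` L = UNIV"
  shows "\<exists>c>0. \<forall>g. c * norm g \<le> lnorm (T' g)"
proof -
  have mem: "T' g \<in> L" for g by (rule bessel_imp_analysis_ell2[OF K])
  define S where "S = {g. lnorm (T' g) \<le> 1}"
  have "\<exists>M. \<forall>g\<in>S. norm (ip y g) \<le> M" for y
  proof -
    obtain f where f: "f \<in> L" "y = T f" using onto by (metis UNIV_I imageE)
    have "norm (ip y g) \<le> lnorm f" if "g \<in> S" for g
    proof -
      have "norm (ip y g) \<le> lnorm f * lnorm (T' g)"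
        unfolding f(2) by (rule norm_ip_synthesis_le[OF f(1) synthesis_summable[OF K f(1)] mem])
      also have "\<dots> \<le> lnorm f * 1"
        using that by (intro mult_left_mono ell2_norm_nonneg) (simp add: S_def)
      finally show ?thesis by simp
    qed
    then show ?thesis by blast
  qed
  then obtain B where B: "\<And>g. g \<in> S \<Longrightarrow> norm g \<le> B"
    using pointwise_bounded_imp_norm_bounded[of S] by blast
  have scale: "lnorm (T' (r *\<^sub>R g)) = \<bar>r\<bar> * lnorm (T' g)" for r g
  proof (rule power2_eq_imp_eq)
    have "T' (r *\<^sub>R g) = (\<lambda>i. r *\<^sub>R T' g i)"
      using analysis_smul[of "of_real r" g] by (simp add: smul_of_real ell2_smul_def)
    then have "norm (T' (r *\<^sub>R g) i) = \<bar>r\<bar> * norm (T' g i)" for i by simp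
    then show "(lnorm (T' (r *\<^sub>R g)))\<^sup>2 = (\<bar>r\<bar> * lnorm (T' g))\<^sup>2"
      by (simp add: ell2_norm_sq[OF mem] power_mult_distrib infsum_cmult_right')
  qed (simp_all add: ell2_norm_nonneg)
  \<comment> \<open>strictly larger than the bound \<open>B\<close>, so that a vector scaled to norm \<open>B'\<close> contradicts it\<close>
  define B' where "B' = max B 0 + 1"
  have B': "B < B'" "0 < B'" by (auto simp: B'_def)
  have "1 / B' * norm g \<le> lnorm (T' g)" for g
  proof (rule ccontr)
    assume "\<not> 1 / B' * norm g \<le> lnorm (T' g)"
    then have lt: "lnorm (T' g) < norm g / B'" by simp
    then have "norm g > 0" using ell2_norm_nonneg[of I "T' g"] B'(2)
      by (metis divide_eq_0_iff norm_ge_zero order_le_less not_le)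
    define r where "r = B' / norm g"
    have "lnorm (T' (r *\<^sub>R g)) \<le> 1"
      unfolding scale using lt \<open>norm g > 0\<close> B'(2) by (simp add: r_def field_simps)
    then have "norm (r *\<^sub>R g) \<le> B" by (intro B) (simp add: S_def)
    then show False using \<open>norm g > 0\<close> B' by (simp add: r_def)
  qed
  then show ?thesis using B'(2) by (intro exI[of _ "1 / B'"]) auto
qed

lemma synthesis_onto_imp_analysis_isomorphism:
  assumes "synthesis_bounded_linear_onto smul ip I W v"
  shows "analysis_into_isomorphism smul ip I W v"
proof -
  obtain K where K: "\<And>f. f \<in> L \<Longrightarrow> norm (T f) \<le> K * lnorm f" and onto: "T ` L = UNIV"
    using assms unfolding synthesis_bounded_linear_onto_def bounded_linear_operator_def by blast
  have "norm (T f) \<le> \<bar>K\<bar> * lnorm f" if "f \<in> L" for f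
    using K[OF that] mult_right_mono[OF abs_ge_self[of K] ell2_norm_nonneg[of I f]] by linarith
  then have "bessel \<bar>K\<bar>" by (intro synthesis_bounded_imp_bessel) auto
  with synthesis_onto_imp_analysis_bounded_below[OF this onto] show ?thesis
    unfolding analysis_into_isomorphism_iff by blast
qed

end

theorem theorem3p12:
  fixes smul :: "'k::rc_scalar \<Rightarrow> 'a::banach \<Rightarrow> 'a"
    and ip :: "'a \<Rightarrow> 'a \<Rightarrow> 'k"
    and I :: "'i set"
    and W :: "'i \<Rightarrow> 'a set"
    and v :: "'i \<Rightarrow> real"
  assumes "hilbert_space smul ip"
    and "separable_space (euclidean :: 'a topology)"
    and "\<And>i. i \<in> I \<Longrightarrow> module.subspace smul (W i)"
    and "\<And>i. i \<in> I \<Longrightarrow> closed (W i)"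
    and "\<And>i. i \<in> I \<Longrightarrow> v i > 0"
  shows "(frame_of_subspaces ip I W v \<longleftrightarrow> synthesis_bounded_linear_onto smul ip I W v) \<and>
         (synthesis_bounded_linear_onto smul ip I W v \<longleftrightarrow> analysis_into_isomorphism smul ip I W v)"
proof -
  interpret subspace_family smul ip I W v
    by (intro subspace_family.intro subspace_family_axioms.intro assms(1,3,4))
  show ?thesis
    using frame_iff_analysis_into_isomorphism analysis_isomorphism_imp_synthesis_onto
      synthesis_onto_imp_analysis_isomorphism by blast
qed

end
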